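(* Let $B\ge 2$ be an integer. There exists an instance $I_1$ of the chance-constrained submodular problem with budget $B$, of the following linear form: $V=\{1,\dots,n\}$ with $n\ge B+1$, $f(S)=|S|$, $\gamma\in(0,1]$, $\alpha\in\left(\frac{\gamma}{3(B-1)^2+\gamma},\frac{\gamma}{3(B-2)^2+\gamma}\right)$, $\delta_1=\sqrt{\gamma}$ and $\delta_i=0$ for all $i\ge 2$, such that the greedy algorithm GA fails to guarantee better than a $(1/B)$-approximation on $I_1$.
   Context: Chance-constrained submodular problem: $V=\{1,\dots,n\}$; $f:2^V\to\mathbb{R}_{\ge 0}$ is monotone and submodular; the budget is $B>1$; the threshold is $\alpha\in[0,1]$ ($\alpha>0$ whenever $\kappa_\alpha$ below is used). Each element $i\in V$ has a random weight $w_i$, independently and uniformly distributed on $[1-\delta_i,1+\delta_i]$ with $0\le\delta_i\le 1$, so $E[w_i]=1$ and $Var[w_i]=\delta_i^2/3$. Write $W(S)=\sum_{i\in S}w_i$. The aim is to maximize $f(S)$ over $S\subseteq V$ subject to $\Pr[W(S)>B]\le\alpha$. Every single element is assumed feasible with respect to $B$. Surrogate weight: $\Gamma(S)=E[W(S)]+\kappa_\alpha\sqrt{Var[W(S)]}=|S|+\kappa_\alpha\sqrt{\sum_{i\in S}\delta_i^2/3}$, where $\kappa_\alpha=\sqrt{(1-\alpha)/\alpha}$. Algorithm GA: start with $S=\emptyset$, $V'=V$. While $V'\ne\emptyset$: pick $v^*\in\arg\max_{v\in V'}\,(f(S\cup\{v\})-f(S))$ (any maximizer may be picked); if $\Gamma(S\cup\{v^*\})\le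 B$, set $S\leftarrow S\cup\{v^*\}$; then set $V'\leftarrow V'\setminus\{v^*\}$. Output $S$. Let $OPT_d$ be an optimal solution of the deterministic instance, i.e. a maximizer of $f$ over sets of size at most $\lfloor B\rfloor$ (all weights equal to $1$). An algorithm "fails to guarantee better than an $r$-approximation" on an instance if some possible output $S$ of it on that instance satisfies $f(S)\le r\cdot f(OPT_d)$. *)

theory Defs
  imports "HOL-Probability.Probability"
begin

record ccs_instance =
  num_elems :: nat
  objective :: "nat set \<Rightarrow> real"
  budget :: real
  threshold :: real
  dev :: "nat \<Rightarrow> real"

definition ground :: "ccs_instance \<Rightarrow> nat set" where
  "ground I = {1..num_elems I}"

definition monotone_submodular_on :: "'a set \<Rightarrow> ('a set \<Rightarrow> real) \<Rightarrow> bool" where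
  "monotone_submodular_on V f \<longleftrightarrow>
     (\<forall>A B. A \<subseteq> B \<and> B \<subseteq> V \<longrightarrow> f A \<le> f B) \<and>
     (\<forall>A B v. A \<subseteq> B \<and> B \<subseteq> V \<and> v \<in> V - B \<longrightarrow>
        f (insert v B) - f B \<le> f (insert v A) - f A)"

(* The uniform distribution on [1 - d, 1 + d]; for d = 0 the interval is a null set and
   uniform_measure is not a probability measure, so the point mass at 1 is given separately. *)
definition weight_distr :: "real \<Rightarrow> real measure" where
  "weight_distr d = (if d > 0 then uniform_measure lborel {1 - d..1 + d} else return borel 1)"

(* Joint law of the independent weights: a sample point is a weight vector w on the ground set. *)
definition weights :: "ccs_instance \<Rightarrow> (nat \<Rightarrow> real) measure" where
  "weights I = (\<Pi>\<^sub>M i\<in>ground I. weight_distr (dev I i))"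

definition total_weight :: "nat set \<Rightarrow> (nat \<Rightarrow> real) \<Rightarrow> real" where
  "total_weight S w = (\<Sum>i\<in>S. w i)"

definition chance_feasible :: "ccs_instance \<Rightarrow> nat set \<Rightarrow> bool" where
  "chance_feasible I S \<longleftrightarrow> S \<subseteq> ground I \<and>
     measure (weights I) {w \<in> space (weights I). total_weight S w > budget I} \<le> threshold I"

definition valid_instance :: "ccs_instance \<Rightarrow> bool" where
  "valid_instance I \<longleftrightarrow>
     (\<forall>S\<subseteq>ground I. 0 \<le> objective I S) \<and>
     monotone_submodular_on (ground I) (objective I) \<and>
     budget I > 1 \<and>
     0 \<le> threshold I \<and> threshold I \<le> 1 \<and>
     (\<forall>i\<in>ground I. 0 \<le> dev I i \<and> dev I i \<le> 1) \<and>
     (\<forall>i\<in>ground I. chance_feasible I {i})"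

(* Meaningful for a > 0 only; division by zero would give kappa 0 = 0. *)
definition kappa :: "real \<Rightarrow> real" where
  "kappa a = sqrt ((1 - a) / a)"

definition surrogate_weight :: "ccs_instance \<Rightarrow> nat set \<Rightarrow> real" where
  "surrogate_weight I S =
     prob_space.expectation (weights I) (total_weight S) +
     kappa (threshold I) * sqrt (prob_space.variance (weights I) (total_weight S))"

(* greedy_state I S R: some run of the algorithm reaches the selected set S with the elements
   of R still unprocessed.  Ties are broken arbitrarily, so this is a relation. *)
inductive greedy_state :: "ccs_instance \<Rightarrow> nat set \<Rightarrow> nat set \<Rightarrow> bool" for I where
  init: "greedy_state I {} (ground I)"
| accept: "greedy_state I S R \<Longrightarrow>
    is_arg_max (\<lambda>u. objective I (insert u S) - objective I S) (\<lambda>u. u \<in> R) v \<Longrightarrow>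
    surrogate_weight I (insert v S) \<le> budget I \<Longrightarrow>
    greedy_state I (insert v S) (R - {v})"
| reject: "greedy_state I S R \<Longrightarrow>
    is_arg_max (\<lambda>u. objective I (insert u S) - objective I S) (\<lambda>u. u \<in> R) v \<Longrightarrow>
    \<not> surrogate_weight I (insert v S) \<le> budget I \<Longrightarrow>
    greedy_state I S (R - {v})"

definition GA_output :: "ccs_instance \<Rightarrow> nat set \<Rightarrow> bool" where
  "GA_output I S \<longleftrightarrow> greedy_state I S {}"

definition det_optimal :: "ccs_instance \<Rightarrow> nat set \<Rightarrow> bool" where
  "det_optimal I T \<longleftrightarrow>
     is_arg_max (objective I) (\<lambda>S. S \<subseteq> ground I \<and> int (card S) \<le> \<lfloor>budget I\<rfloor>) T"

definition fails_better_than ::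
  "(ccs_instance \<Rightarrow> nat set \<Rightarrow> bool) \<Rightarrow> real \<Rightarrow> ccs_instance \<Rightarrow> bool" where
  "fails_better_than alg r I \<longleftrightarrow>
     (\<exists>S T. alg I S \<and> det_optimal I T \<and> objective I S \<le> r * objective I T)"


lemma prob_space_weight_distr: "prob_space (weight_distr d)"
  unfolding weight_distr_def
  by (auto intro!: prob_space_uniform_measure prob_space_return)

lemma sets_weight_distr [measurable_cong, simp]: "sets (weight_distr d) = sets borel"
  by (simp add: weight_distr_def)

lemma AE_weight_distr: "0 \<le> d \<Longrightarrow> AE x in weight_distr d. 1 - d \<le> x \<and> x \<le> 1 + d"
  unfolding weight_distr_def
  by (auto simp: AE_return intro!: AE_uniform_measureI)

lemma weight_distr_bounded_integrable:
  fixes f :: "real \<Rightarrow> real"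
  assumes "0 \<le> d" "f \<in> borel_measurable borel"
    and "\<And>x. 1 - d \<le> x \<Longrightarrow> x \<le> 1 + d \<Longrightarrow> \<bar>f x\<bar> \<le> c"
  shows "integrable (weight_distr d) f"
proof -
  interpret prob_space "weight_distr d" by (rule prob_space_weight_distr)
  show ?thesis
  proof (rule integrable_const_bound[where B = c])
    show "AE x in weight_distr d. norm (f x) \<le> c"
      using AE_weight_distr[OF assms(1)] by (rule eventually_mono) (use assms(3) in auto)
  qed (use assms(2) in auto)
qed

lemma weight_distr_moments:
  assumes "0 \<le> d"
  shows "prob_space.expectation (weight_distr d) (\<lambda>x. x) = 1"
    and "prob_space.variance (weight_distr d) (\<lambda>x. x) = d\<^sup>2 / 3"
proof -
  interpret prob_space "weight_distr d" by (rule prob_space_weight_distr)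
  have "expectation (\<lambda>x. x) = 1 \<and> variance (\<lambda>x. x) = d\<^sup>2 / 3"
  proof (cases "d > 0")
    case True
    have D: "distributed (weight_distr d) lborel (\<lambda>x. x)
        (\<lambda>x. indicator {1 - d..1 + d} x / measure lborel {1 - d..1 + d})"
    proof -
      have "distr (weight_distr d) lborel (\<lambda>x. x) = weight_distr d"
        by (rule distr_id2) simp
      also have "\<dots> = density lborel
          (\<lambda>x. ennreal (indicator {1 - d..1 + d} x / measure lborel {1 - d..1 + d}))"
        using True unfolding weight_distr_def uniform_measure_def
        by (auto intro!: arg_cong[where f = "density lborel"] split: split_indicator
              simp: fun_eq_iff divide_ennreal simp flip: ennreal_1)
      finally show ?thesis by (simp add: distributed_def)
    qed
    show ?thesis
      using uniform_distributed_expectation[OF D] uniform_distributed_variance[OF D]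
      by (simp add: power2_eq_square)
  next
    case False
    with assms have "d = 0" by simp
    then show ?thesis by (simp add: weight_distr_def integral_return)
  qed
  then show "expectation (\<lambda>x. x) = 1" "variance (\<lambda>x. x) = d\<^sup>2 / 3" by auto
qed

lemma surrogate_weight_eq:
  assumes "\<And>i. i \<in> ground I \<Longrightarrow> 0 \<le> dev I i" "S \<subseteq> ground I"
  shows "surrogate_weight I S =
    real (card S) + kappa (threshold I) * sqrt (\<Sum>i\<in>S. (dev I i)\<^sup>2 / 3)"
proof -
  let ?V = "ground I" and ?D = "\<lambda>i. weight_distr (dev I i)" and ?M = "weights I"
  interpret product_prob_space ?D ?V
    unfolding product_prob_space_def product_prob_space_axioms_def product_sigma_finite_def
    by (auto intro: prob_space_weight_distr prob_space_imp_sigma_finite)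
  have fin: "finite ?V" by (simp add: ground_def)
  have finS: "finite S" using assms(2) fin by (rule finite_subset)
  have int_pow: "integrable (?D i) (\<lambda>x. (x - 1) ^ n)" if "i \<in> ?V" for i n
    using assms(1)[OF that]
    by (intro weight_distr_bounded_integrable[where c = "dev I i ^ n"])
       (auto simp: power_abs intro!: power_mono)
  have int1: "integral\<^sup>L (?D i) (\<lambda>x. x - 1) = 0" if "i \<in> ?V" for i
  proof -
    have "integrable (?D i) (\<lambda>x. x)"
      using assms(1)[OF that]
      by (intro weight_distr_bounded_integrable[where c = "1 + dev I i"]) auto
    then show ?thesis
      using weight_distr_moments(1)[OF assms(1)[OF that]] by (simp add: prob_space.prob_space[OF prob_space_weight_distr])
  qed
  have int2: "integral\<^sup>L (?D i) (\<lambda>x. (x - 1)\<^sup>2) = (dev I i)\<^sup>2 / 3" if "i \<in> ?V" for i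
    using weight_distr_moments[OF assms(1)[OF that]] by simp
  define g :: "nat \<Rightarrow> nat \<Rightarrow> nat \<Rightarrow> real \<Rightarrow> real"
    where "g = (\<lambda>i j k x. (x - 1) ^ (of_bool (k = i) + of_bool (k = j)))"
  have g_prod: "(\<Prod>k\<in>?V. g i j k (w k)) = (w i - 1) * (w j - 1)"
    if "i \<in> ?V" "j \<in> ?V" for i j and w :: "nat \<Rightarrow> real"
    using that fin by (simp add: g_def power_add prod.distrib of_bool_def if_distrib[of "\<lambda>n. _ ^ n"] cong: if_cong)
  have int_g: "integrable (?D k) (g i j k)" if "k \<in> ?V" for i j k
    unfolding g_def using int_pow[OF that] .
  have cov_int: "integrable ?M (\<lambda>w. (w i - 1) * (w j - 1))" if "i \<in> ?V" "j \<in> ?V" for i j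
    using product_integrable_prod[OF fin, of "g i j", OF int_g] g_prod[OF that]
    by (simp add: weights_def)
  have cov: "integral\<^sup>L ?M (\<lambda>w. (w i - 1) * (w j - 1)) = (if i = j then (dev I i)\<^sup>2 / 3 else 0)"
    if "i \<in> ?V" "j \<in> ?V" for i j
  proof -
    have "integral\<^sup>L ?M (\<lambda>w. (w i - 1) * (w j - 1)) = (\<Prod>k\<in>?V. integral\<^sup>L (?D k) (g i j k))"
      using product_integral_prod[OF fin, of "g i j", OF int_g] g_prod[OF that]
      by (simp add: weights_def)
    also have "\<dots> = (if i = j then (dev I i)\<^sup>2 / 3 else 0)"
    proof (cases "i = j")
      case True
      have "(\<Prod>k\<in>?V. integral\<^sup>L (?D k) (g i j k)) = (\<Prod>k\<in>?V. if k = i then (dev I i)\<^sup>2 / 3 else 1)"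
        using True int2[OF that(1)]
        by (intro prod.cong)
           (auto simp: g_def numeral_2_eq_2 prob_space.prob_space[OF prob_space_weight_distr])
      then show ?thesis using True that fin by simp
    next
      case False
      then have "integral\<^sup>L (?D i) (g i j i) = 0"
        using int1[OF that(1)] by (simp add: g_def)
      then show ?thesis using False that fin by (auto intro!: prod_zero)
    qed
    finally show ?thesis .
  qed
  have comp: "integrable ?M (\<lambda>w. w i) \<and> integral\<^sup>L ?M (\<lambda>w. w i) = 1" if "i \<in> ?V" for i
  proof -
    have D: "distr ?M (?D i) (\<lambda>w. w i) = ?D i"
      unfolding weights_def by (rule distr_PiM_component[OF prob_space_weight_distr that])
    have m: "(\<lambda>w. w i) \<in> measurable ?M (?D i)"
      unfolding weights_def by (rule measurable_component_singleton[OF that])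
    have i: "integrable (?D i) (\<lambda>x. x)"
      using assms(1)[OF that]
      by (intro weight_distr_bounded_integrable[where c = "1 + dev I i"]) auto
    have "integrable ?M (\<lambda>w. w i)"
      using integrable_distr[OF m, of "\<lambda>x. x"] i by (simp add: D)
    moreover have "integral\<^sup>L ?M (\<lambda>w. w i) = integral\<^sup>L (?D i) (\<lambda>x. x)"
      using integral_distr[OF m, of "\<lambda>x. x"] by (simp add: D)
    ultimately show ?thesis
      using weight_distr_moments(1)[OF assms(1)[OF that]] by simp
  qed
  have E: "integral\<^sup>L ?M (total_weight S) = real (card S)"
    using comp assms(2) unfolding total_weight_def
    by (subst Bochner_Integration.integral_sum) (auto simp: subset_iff)
  have "(\<integral>w. (total_weight S w - real (card S))\<^sup>2 \<partial>?M) =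
      (\<integral>w. (\<Sum>i\<in>S. \<Sum>j\<in>S. (w i - 1) * (w j - 1)) \<partial>?M)"
    by (intro Bochner_Integration.integral_cong)
       (auto simp: total_weight_def sum_subtractf power2_eq_square simp flip: sum_product)
  also have "\<dots> = (\<Sum>i\<in>S. \<Sum>j\<in>S. if i = j then (dev I i)\<^sup>2 / 3 else 0)"
    using assms(2) cov_int cov
    by (subst Bochner_Integration.integral_sum
        | (subst sum.cong[OF refl Bochner_Integration.integral_sum]))+
       (auto intro!: sum.cong Bochner_Integration.integrable_sum
             simp: subset_iff Bochner_Integration.integral_sum)
  also have "\<dots> = (\<Sum>i\<in>S. (dev I i)\<^sup>2 / 3)"
    using finS by (intro sum.cong) auto
  finally show ?thesis
    by (simp add: surrogate_weight_def E)
qed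


end

theory Submission
  imports Defs
begin

text \<open>
  Take \<open>\<gamma> = 1\<close>, \<open>n = B + 1\<close> and \<open>\<alpha> = 1 / (3 (B - 3/2)\<^sup>2 + 1)\<close>, so that
  \<open>\<kappa>\<^sub>\<alpha> * sqrt (1 / 3) = B - 3/2\<close>. All marginal gains are equal, so the greedy
  algorithm may start with the only random element \<open>1\<close>, whose surrogate weight is \<open>B - 1/2\<close>.
  Every further element raises the surrogate weight to \<open>B + 1/2\<close> and is rejected, so the
  output is \<open>{1}\<close>, while the deterministic optimum has \<open>B\<close> elements.
\<close>

text \<open>The weight of \<open>i\<close> almost surely stays below \<open>1 + dev I i\<close>,
  hence within the budget, so overflow is a null event.\<close>

lemma chance_feasible_singleton:
  assumes "i \<in> ground I" "0 \<le> dev I i" "1 + dev I i \<le> budget I" "0 \<le> threshold I"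
  shows "chance_feasible I {i}"
proof -
  interpret prob_space "weights I"
    unfolding weights_def by (intro prob_space_PiM prob_space_weight_distr)
  have "AE w in weights I. 1 - dev I i \<le> w i \<and> w i \<le> 1 + dev I i"
    unfolding weights_def
    using prob_space_weight_distr assms(1) AE_weight_distr[OF assms(2)]
    by (rule AE_PiM_component)
  then have "AE w in weights I. w \<notin> {w \<in> space (weights I). total_weight {i} w > budget I}"
    by eventually_elim (use assms(3) in \<open>auto simp: total_weight_def\<close>)
  moreover have "{w \<in> space (weights I). total_weight {i} w > budget I} \<in> events"
    using assms(1) unfolding total_weight_def weights_def by simp
  ultimately have "prob {w \<in> space (weights I). total_weight {i} w > budget I} = 0"
    by (simp add: prob_eq_0)
  then show ?thesis
    using assms(1,4) by (simp add: chance_feasible_def)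
qed

lemma monotone_submodular_on_card:
  assumes "finite V"
  shows "monotone_submodular_on V (\<lambda>S. real (card S))"
proof -
  have "finite B" "finite A" if "A \<subseteq> B" "B \<subseteq> V" for A B
    using that assms by (auto intro: finite_subset)
  then show ?thesis
    unfolding monotone_submodular_on_def
    by (auto intro: card_mono simp: card_insert_if)
qed

text \<open>A rejection keeps \<open>S\<close>, so the last assumption passes to the smaller
  remainder. Finiteness of \<open>R\<close> provides a maximizer of the gain, so the run never gets
  stuck.\<close>

lemma GA_output_if_all_rejected:
  assumes "finite R" "greedy_state I S R"
    and "\<And>v. v \<in> R \<Longrightarrow> budget I < surrogate_weight I (insert v S)"
  shows "GA_output I S"
  using assms
proof (induction R rule: finite_psubset_induct)
  case (psubset R)
  show ?case
  proof (cases "R = {}")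
    case True
    with psubset.prems show ?thesis by (simp add: GA_output_def)
  next
    case False
    let ?g = "\<lambda>u. objective I (insert u S) - objective I S"
    have "Max (?g ` R) \<in> ?g ` R"
      using False psubset.hyps by simp
    then obtain v where v: "v \<in> R" "?g v = Max (?g ` R)" by auto
    then have "is_arg_max ?g (\<lambda>u. u \<in> R) v"
      using psubset.hyps by (auto simp: is_arg_max_linorder)
    then have "greedy_state I S (R - {v})"
      using psubset.prems v(1) by (intro greedy_state.reject) (auto simp: not_le)
    then show ?thesis
      using psubset.IH[of "R - {v}"] psubset.prems v(1) by auto
  qed
qed

theorem theorem2:
  fixes B :: nat
  assumes "B \<ge> 2"
  shows "\<exists>I \<gamma>. valid_instance I \<and>
    budget I = real B \<and>
    num_elems I \<ge> B + 1 \<and>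
    (\<forall>S\<subseteq>ground I. objective I S = real (card S)) \<and>
    \<gamma> \<in> {0<..1} \<and>
    threshold I \<in> {\<gamma> / (3 * (real B - 1)\<^sup>2 + \<gamma>) <..< \<gamma> / (3 * (real B - 2)\<^sup>2 + \<gamma>)} \<and>
    dev I 1 = sqrt \<gamma> \<and>
    (\<forall>i\<in>ground I. i \<ge> 2 \<longrightarrow> dev I i = 0) \<and>
    fails_better_than GA_output (1 / real B) I"
proof -
  define c :: real where "c = real B - 3 / 2"
  define I where "I = \<lparr>num_elems = B + 1, objective = (\<lambda>S. real (card S)), budget = real B,
    threshold = 1 / (3 * c\<^sup>2 + 1), dev = (\<lambda>i. if i = 1 then 1 else 0)\<rparr>"
  \<comment> \<open>These bounds serve twice: \<open>c_less\<close> makes \<open>{1}\<close> fit and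
    \<open>c_greater\<close> makes a second element overflow; squared, they place the threshold in
    its interval. The absolute value supplies the nonnegativity needed for squaring.\<close>
  have c: "0 < c" and c_less: "c < real B - 1" and c_greater: "\<bar>real B - 2\<bar> < c"
    using assms by (auto simp: c_def abs_if)
  have I_simps [simp]: "objective I = (\<lambda>S. real (card S))" "budget I = real B"
    "threshold I = 1 / (3 * c\<^sup>2 + 1)" "dev I = (\<lambda>i. if i = 1 then 1 else 0)"
    "num_elems I = B + 1"
    by (simp_all add: I_def)
  have ground: "ground I = {1..B + 1}"
    by (simp add: ground_def)
  have pos: "0 < 3 * c\<^sup>2 + 1"
    using zero_le_power2[of c] by linarith
  \<comment> \<open>A threshold of the form \<open>1 / (t + 1)\<close> gives
    \<open>(1 - a) / a = t\<close>; here \<open>t\<close> is \<open>3 * c\<^sup>2\<close>, whose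
    factor 3 cancels the variance \<open>1 / 3\<close> of element 1.\<close>
  have "kappa (threshold I) = sqrt (3 * c\<^sup>2)"
    using pos by (simp add: kappa_def field_simps)
  then have kappa: "kappa (threshold I) * sqrt (1 / 3) = c"
    using c by (simp add: real_sqrt_mult real_sqrt_divide)
  have surrogate: "surrogate_weight I S = real (card S) + c" if "1 \<in> S" "S \<subseteq> ground I" for S
  proof -
    have "finite S"
      using that(2) by (rule finite_subset) (simp add: ground)
    have "(\<Sum>i\<in>S. (dev I i)\<^sup>2 / 3) = (\<Sum>i\<in>S. if i = 1 then 1 / 3 else 0)"
      by (intro sum.cong) auto
    also have "\<dots> = 1 / 3"
      using that(1) \<open>finite S\<close> by simp
    finally have sum: "(\<Sum>i\<in>S. (dev I i)\<^sup>2 / 3) = 1 / 3" .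
    have "surrogate_weight I S =
        real (card S) + kappa (threshold I) * sqrt (\<Sum>i\<in>S. (dev I i)\<^sup>2 / 3)"
      using that(2) by (intro surrogate_weight_eq) auto
    then show ?thesis
      by (simp only: sum kappa)
  qed

  \<comment> \<open>Element 1 can weigh up to 2, so its feasibility rests on
    \<open>B \<ge> 2\<close>.\<close>
  have "valid_instance I"
    using assms monotone_submodular_on_card[of "ground I"] pos
    by (auto simp: valid_instance_def ground intro!: chance_feasible_singleton)

  have "is_arg_max (\<lambda>u. objective I (insert u {}) - objective I {}) (\<lambda>u. u \<in> ground I) 1"
    by (auto simp: is_arg_max_linorder ground)
  moreover have "surrogate_weight I (insert 1 {}) \<le> budget I"
    using c_less by (subst surrogate) (auto simp: ground)
  ultimately have "greedy_state I (insert 1 {}) (ground I - {1})"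
    by (intro greedy_state.accept greedy_state.init)
  \<comment> \<open>As \<open>v\<close> differs from 1, the set has two elements and surrogate
    weight \<open>2 + c\<close>.\<close>
  moreover have "budget I < surrogate_weight I (insert v (insert 1 {}))"
    if "v \<in> ground I - {1}" for v
    using c_greater that by (subst surrogate) (auto simp: ground)
  ultimately have "GA_output I {1}"
    by (intro GA_output_if_all_rejected[of "ground I - {1}"]) (auto simp: ground)
  moreover have "det_optimal I {1..B}"
    by (auto simp: det_optimal_def is_arg_max_linorder ground)
  ultimately have "fails_better_than GA_output (1 / real B) I"
    using assms unfolding fails_better_than_def
    by (intro exI[of _ "{1}"] exI[of _ "{1..B}"]) simp
  \<comment> \<open>The map from x to \<open>1 / (3 * x\<^sup>2 + 1)\<close> decreases for
    nonnegative x, so the bounds on \<open>c\<close> swap sides. For \<open>B = 2\<close> the upper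
    endpoint is 1.\<close>
  moreover have "threshold I \<in> {1 / (3 * (real B - 1)\<^sup>2 + 1) <..< 1 / (3 * (real B - 2)\<^sup>2 + 1)}"
  proof -
    have "c\<^sup>2 < (real B - 1)\<^sup>2"
      using c c_less by (intro power_strict_mono) auto
    moreover have "(real B - 2)\<^sup>2 < c\<^sup>2"
      using power_strict_mono[OF c_greater, of 2] by simp
    moreover have "0 < 3 * (real B - 2)\<^sup>2 + 1"
      using zero_le_power2[of "real B - 2"] by linarith
    ultimately show ?thesis
      using pos by (auto intro!: divide_strict_left_mono mult_pos_pos)
  qed
  ultimately show ?thesis
    using \<open>valid_instance I\<close> by (intro exI[of _ I] exI[of _ 1]) (auto simp: ground)
qed

end
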